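(* Every (completely regular) topological space is a continuous image of a nowhere locally compact space whose Stone–Čech remainder is $\sigma$-compact.
   Context: A space is nowhere locally compact if every compact subset has empty interior. The Stone–Čech remainder of $X$ is $\beta X\setminus X$. *)

theory Defs
  imports "HOL-Analysis.Analysis"
begin

definition nowhere_locally_compact_space :: "'a topology \<Rightarrow> bool" where
  "nowhere_locally_compact_space X \<longleftrightarrow> (\<forall>K. compactin X K \<longrightarrow> X interior_of K = {})"

definition sigma_compact_space :: "'a topology \<Rightarrow> bool" where
  "sigma_compact_space X \<longleftrightarrow>
     (\<exists>\<K>. countable \<K> \<and> (\<forall>K\<in>\<K>. compactin X K) \<and> \<Union>\<K> = topspace X)"

text \<open>The Stone-Cech compactification is the closure of the image of \<open>X\<close> under the evaluation map
  into the Tychonoff cube indexed by all continuous functions from \<open>X\<close> to the unit interval.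
  Functions are taken extensional on the carrier of \<open>X\<close>, so that each one is counted once.
  The evaluation map is an embedding exactly when \<open>X\<close> is completely regular and Hausdorff; only
  then does the remainder below have its usual meaning.\<close>

definition unit_interval_maps :: "'a topology \<Rightarrow> ('a \<Rightarrow> real) set" where
  "unit_interval_maps X =
     {f \<in> extensional (topspace X). continuous_map X (top_of_set {0..1}) f}"

definition stone_cech_cube :: "'a topology \<Rightarrow> (('a \<Rightarrow> real) \<Rightarrow> real) topology" where
  "stone_cech_cube X = product_topology (\<lambda>f. top_of_set {0..1}) (unit_interval_maps X)"

definition stone_cech_map :: "'a topology \<Rightarrow> 'a \<Rightarrow> (('a \<Rightarrow> real) \<Rightarrow> real)" where
  "stone_cech_map X x = (\<lambda>f\<in>unit_interval_maps X. f x)"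

definition stone_cech :: "'a topology \<Rightarrow> (('a \<Rightarrow> real) \<Rightarrow> real) topology" where
  "stone_cech X =
     subtopology (stone_cech_cube X) (stone_cech_cube X closure_of (stone_cech_map X ` topspace X))"

definition stone_cech_remainder :: "'a topology \<Rightarrow> (('a \<Rightarrow> real) \<Rightarrow> real) topology" where
  "stone_cech_remainder X =
     subtopology (stone_cech X) (topspace (stone_cech X) - stone_cech_map X ` topspace X)"

lemma restrict_in_unit_interval_maps:
  assumes "continuous_map X (top_of_set {0..1}) f"
  shows "restrict f (topspace X) \<in> unit_interval_maps X"
  unfolding unit_interval_maps_def using continuous_map_eq [OF assms, of "restrict f (topspace X)"]
  by simp

lemma unit_interval_maps_eq_mspace:
  "unit_interval_maps X = mspace (submetric (cfunspace X euclidean_metric) {f. f \<in> topspace X \<rightarrow> {0..1}})"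
proof -
  have *: "bounded (f ` topspace X)" if "f \<in> topspace X \<rightarrow> {0..1}" for f :: "'a \<Rightarrow> real"
    using that bounded_closed_interval [of 0 "1::real"] bounded_subset image_subset_iff_funcset by metis
  show ?thesis
    unfolding unit_interval_maps_def continuous_map_in_subtopology set_eq_iff
    by simp (use * in blast)
qed

lemma embedding_map_stone_cech_cube:
  assumes "completely_regular_space X" "Hausdorff_space X"
  shows "embedding_map X (stone_cech_cube X) (stone_cech_map X)"
  unfolding stone_cech_cube_def stone_cech_map_def [abs_def]
  using completely_regular_space_cube_embedding_explicit [OF assms]
  unfolding unit_interval_maps_eq_mspace[symmetric] .

lemma continuous_map_stone_cech_cube: "continuous_map X (stone_cech_cube X) (stone_cech_map X)"
  unfolding stone_cech_cube_def stone_cech_map_def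
  by (simp add: continuous_map_componentwise image_subset_iff) (simp add: unit_interval_maps_def)

lemma compact_stone_cech_cube: "compact_space (stone_cech_cube X)"
  by (simp add: stone_cech_cube_def compact_space_product_topology compact_space_subtopology)

lemma Hausdorff_stone_cech_cube: "Hausdorff_space (stone_cech_cube X)"
  by (simp add: stone_cech_cube_def Hausdorff_space_product_topology Hausdorff_space_subtopology)

lemma stone_cech_map_subset_closure:
  "stone_cech_map X ` topspace X \<subseteq> stone_cech_cube X closure_of (stone_cech_map X ` topspace X)"
  by (simp add: closure_of_subset continuous_map_image_subset_topspace continuous_map_stone_cech_cube)

lemma compact_space_stone_cech: "compact_space (stone_cech X)"
  by (simp add: stone_cech_def closedin_compact_space compact_space_subtopology
      compact_stone_cech_cube)

lemma Hausdorff_space_stone_cech: "Hausdorff_space (stone_cech X)"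
  by (simp add: stone_cech_def Hausdorff_space_subtopology Hausdorff_stone_cech_cube)

lemma continuous_map_stone_cech: "continuous_map X (stone_cech X) (stone_cech_map X)"
  using stone_cech_map_subset_closure[of X] continuous_map_stone_cech_cube[of X]
  by (simp add: stone_cech_def continuous_map_in_subtopology image_subset_iff)

lemma embedding_map_stone_cech:
  assumes "completely_regular_space X" "Hausdorff_space X"
  shows "embedding_map X (stone_cech X) (stone_cech_map X)"
  unfolding stone_cech_def embedding_map_in_subtopology
  by (rule conjI [OF embedding_map_stone_cech_cube [OF assms] stone_cech_map_subset_closure])

lemma stone_cech_dense:
  "stone_cech X closure_of (stone_cech_map X ` topspace X) = topspace (stone_cech X)"
  unfolding stone_cech_def
  using stone_cech_map_subset_closure[of X]
  by (simp add: closure_of_subtopology Int_absorb1 closure_of_subset_topspace)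

text \<open>The universal property.\<close>

lemma stone_cech_extension:
  fixes X :: "'b topology" and K :: "'a topology"
  assumes "compact_space K" "Hausdorff_space K" "continuous_map X K g"
  obtains G where "continuous_map (stone_cech X) K G"
    and "\<And>x. x \<in> topspace X \<Longrightarrow> G (stone_cech_map X x) = g x"
proof -
  let ?u = "\<lambda>h. restrict (h \<circ> g) (topspace X)"
  define F where "F = (\<lambda>p::('b \<Rightarrow> real) \<Rightarrow> real. \<lambda>h\<in>unit_interval_maps K. p (?u h))"
  have u: "?u h \<in> unit_interval_maps X" if "h \<in> unit_interval_maps K" for h
    using that unfolding unit_interval_maps_def [of K]
    by (intro restrict_in_unit_interval_maps continuous_map_compose [OF assms(3)]) simp
  have "continuous_map (stone_cech_cube X) (top_of_set {0..1}) (\<lambda>p. p (?u h))"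
    if "h \<in> unit_interval_maps K" for h
    unfolding stone_cech_cube_def
    using continuous_map_product_projection [OF u [OF that], of "\<lambda>_. top_of_set {0..1}"] .
  then have contF: "continuous_map (stone_cech_cube X) (stone_cech_cube K) F"
    unfolding F_def stone_cech_cube_def [of K]
    by (simp add: continuous_map_componentwise image_subset_iff)
  have gK: "g x \<in> topspace K" if "x \<in> topspace X" for x
    using assms(3) that by (auto simp: continuous_map_def)
  have Fx: "F (stone_cech_map X x) = stone_cech_map K (g x)" if "x \<in> topspace X" for x
  proof
    fix h
    show "F (stone_cech_map X x) h = stone_cech_map K (g x) h"
      using that u [of h] by (cases "h \<in> unit_interval_maps K") (simp_all add: F_def stone_cech_map_def)
  qed
  have "completely_regular_space K"
    by (simp add: assms(1,2) compact_Hausdorff_or_regular_imp_normal_space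
        normal_imp_completely_regular_space)
  then have emb: "embedding_map K (stone_cech_cube K) (stone_cech_map K)"
    using assms(2) by (rule embedding_map_stone_cech_cube)
  let ?I = "stone_cech_map K ` topspace K"
  have "compactin (stone_cech_cube K) ?I"
    using assms(1) unfolding compact_space_def
    by (rule image_compactin [OF _ continuous_map_stone_cech_cube])
  then have closed: "closedin (stone_cech_cube K) ?I"
    by (rule compactin_imp_closedin [OF Hausdorff_stone_cech_cube])
  obtain r where r: "homeomorphic_maps K (subtopology (stone_cech_cube K) ?I) (stone_cech_map K) r"
    using emb unfolding embedding_map_def homeomorphic_map_maps by blast
  have "F ` (stone_cech_cube X closure_of (stone_cech_map X ` topspace X))
      \<subseteq> stone_cech_cube K closure_of (F ` (stone_cech_map X ` topspace X))"
    by (rule continuous_map_image_closure_subset [OF contF])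
  also have "\<dots> \<subseteq> ?I"
    using Fx gK by (intro closure_of_minimal closed) auto
  finally have "continuous_map (stone_cech X) (subtopology (stone_cech_cube K) ?I) F"
    using contF unfolding stone_cech_def
    by (simp add: continuous_map_in_subtopology continuous_map_from_subtopology image_subset_iff)
  then have "continuous_map (stone_cech X) K (r \<circ> F)"
    using r unfolding homeomorphic_maps_def by (blast intro: continuous_map_compose)
  moreover have "(r \<circ> F) (stone_cech_map X x) = g x" if "x \<in> topspace X" for x
    using r that by (simp add: Fx gK homeomorphic_maps_def)
  ultimately show thesis
    using that by blast
qed

end

theory Submission
  imports Defs
begin

text \<open>
  Let \<open>D\<close> be \<open>X\<close> with the discrete topology and \<open>P\<close> the set of irrationals in \<open>(0,1)\<close>. Then
  \<open>Y = D \<times> P\<close> is nowhere locally compact and the first projection maps it continuously onto \<open>X\<close>.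
  If \<open>D\<^sup>*\<close> denotes the one-point compactification of \<open>D\<close>, the complement of \<open>Y\<close> in the compact
  Hausdorff space \<open>D\<^sup>* \<times> [0,1]\<close> is the union of \<open>{\<infinity>} \<times> [0,1]\<close> and of the countably many
  slices \<open>D\<^sup>* \<times> {q}\<close> with \<open>q\<close> rational. The extension to \<open>\<beta>Y\<close> of the inclusion
  of \<open>Y\<close> maps remainder to remainder, so the preimages of these compact sets cover exactly the
  remainder of \<open>\<beta>Y\<close>.
\<close>

text \<open>If \<open>G p = g y\<close>, separate \<open>p\<close> from the image of
  \<open>y\<close> in \<open>stone_cech Y\<close> by disjoint open sets \<open>U\<close> and
  \<open>V\<close>. As \<open>g\<close> is an embedding, every \<open>z\<close> in \<open>Y\<close>
  with \<open>g z\<close> near \<open>g y\<close> is mapped into \<open>V\<close>. Density of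
  \<open>Y\<close> and continuity of \<open>G\<close> at \<open>p\<close> give such a
  \<open>z\<close> that is also mapped into \<open>U\<close>.\<close>

lemma stone_cech_extension_remainder:
  assumes emb: "embedding_map Y K g"
    and G: "continuous_map (stone_cech Y) K G"
    and Gg: "\<And>y. y \<in> topspace Y \<Longrightarrow> G (stone_cech_map Y y) = g y"
    and p: "p \<in> topspace (stone_cech Y)" "p \<notin> stone_cech_map Y ` topspace Y"
  shows "G p \<notin> g ` topspace Y"
proof
  assume "G p \<in> g ` topspace Y"
  then obtain y where y: "y \<in> topspace Y" "G p = g y"
    by blast
  let ?e = "stone_cech_map Y"
  have ey: "?e y \<in> topspace (stone_cech Y)"
    using continuous_map_stone_cech[of Y] y(1) by (auto simp: continuous_map_def)
  have "p \<noteq> ?e y"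
    using p y by blast
  then obtain U V where UV: "openin (stone_cech Y) U" "openin (stone_cech Y) V"
      "p \<in> U" "?e y \<in> V" "disjnt U V"
    using Hausdorff_space_stone_cech[of Y] p(1) ey unfolding Hausdorff_space_def by meson
  define N where "N = {z \<in> topspace Y. ?e z \<in> V}"
  have N: "openin Y N"
    unfolding N_def by (rule openin_continuous_map_preimage [OF continuous_map_stone_cech UV(2)])
  have hom: "homeomorphic_map Y (subtopology K (g ` topspace Y)) g"
    using emb unfolding embedding_map_def .
  then have "openin (subtopology K (g ` topspace Y)) (g ` N)"
    using N homeomorphic_imp_open_map open_map_def by blast
  then obtain W where W: "openin K W" "g ` N = W \<inter> g ` topspace Y"
    unfolding openin_subtopology by blast
  have inj: "inj_on g (topspace Y)"
    using hom by (simp add: homeomorphic_imp_injective_map)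
  define O' where "O' = {q \<in> topspace (stone_cech Y). G q \<in> W} \<inter> U"
  have "openin (stone_cech Y) O'"
    unfolding O'_def using openin_continuous_map_preimage [OF G W(1)] UV(1) by blast
  \<comment> \<open>Since \<open>y \<in> N\<close>, the point \<open>G p = g y\<close> lies in
    \<open>W\<close>.\<close>
  moreover have "p \<in> O'"
    using W(2) UV y p unfolding O'_def N_def by auto
  ultimately obtain z where z: "z \<in> topspace Y" "?e z \<in> O'"
    using stone_cech_dense[of Y] p(1) unfolding in_closure_of set_eq_iff by blast
  then have "g z \<in> g ` N"
    using Gg W(2) unfolding O'_def by auto
  then have "z \<in> N"
    using inj z(1) unfolding N_def inj_on_def by auto
  then show False
    using z UV(5) unfolding N_def O'_def disjnt_def by blast
qed

text \<open>This reduces the claim about the Stone-Cech remainder to any one Hausdorff compact space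
  containing \<open>Y\<close>. Preimages of compact sets under the extension \<open>G\<close> are
  closed in \<open>stone_cech Y\<close>, hence compact.\<close>

lemma sigma_compact_stone_cech_remainder:
  assumes K: "compact_space K" "Hausdorff_space K"
    and emb: "embedding_map Y K g"
    and sigma: "sigma_compact_space (subtopology K (topspace K - g ` topspace Y))"
  shows "sigma_compact_space (stone_cech_remainder Y)"
proof -
  let ?e = "stone_cech_map Y"
  let ?R = "topspace K - g ` topspace Y"
  obtain \<K> where "countable \<K> \<and> (\<forall>C\<in>\<K>. compactin (subtopology K ?R) C) \<and>
      \<Union>\<K> = topspace (subtopology K ?R)"
    using sigma unfolding sigma_compact_space_def by (rule exE)
  then have \<K>: "countable \<K>" "\<And>C. C \<in> \<K> \<Longrightarrow> compactin K C" "\<Union>\<K> = ?R"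
    by (simp_all add: compactin_subtopology Int_absorb1)
  have "continuous_map Y K g"
    using emb unfolding embedding_map_def
    by (blast dest: homeomorphic_imp_continuous_map continuous_map_into_fulltopology)
  then obtain G where G: "continuous_map (stone_cech Y) K G"
      and Gg: "\<And>y. y \<in> topspace Y \<Longrightarrow> G (?e y) = g y"
    using stone_cech_extension [OF K] by blast
  define F where "F C = {p \<in> topspace (stone_cech Y). G p \<in> C}" for C
  have "compactin (stone_cech Y) (F C)" if "C \<in> \<K>" for C
    unfolding F_def
    using closedin_continuous_map_preimage [OF G] compactin_imp_closedin [OF K(2) \<K>(2) [OF that]]
      closedin_compact_space compact_space_stone_cech by blast
  moreover have "(\<Union>C\<in>\<K>. F C) = topspace (stone_cech Y) - ?e ` topspace Y"
  proof (intro equalityI subsetI)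
    fix p assume "p \<in> (\<Union>C\<in>\<K>. F C)"
    then have "p \<in> topspace (stone_cech Y)" "G p \<notin> g ` topspace Y"
      using \<K>(3) unfolding F_def by auto
    then show "p \<in> topspace (stone_cech Y) - ?e ` topspace Y"
      using Gg by auto
  next
    fix p assume p: "p \<in> topspace (stone_cech Y) - ?e ` topspace Y"
    then have "G p \<in> topspace K"
      using G by (auto simp: continuous_map_def)
    then have "G p \<in> \<Union>\<K>"
      using stone_cech_extension_remainder [OF emb G Gg] p \<K>(3) by blast
    then show "p \<in> (\<Union>C\<in>\<K>. F C)"
      using p unfolding F_def by auto
  qed
  ultimately show ?thesis
    unfolding sigma_compact_space_def stone_cech_remainder_def
    using \<K>(1) by (intro exI[of _ "F ` \<K>"]) (auto simp: compactin_subtopology)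
qed

lemma embedding_map_prod:
  assumes f: "embedding_map X X' f" and g: "embedding_map Y Y' g"
  shows "embedding_map (prod_topology X Y) (prod_topology X' Y') (\<lambda>(x,y). (f x, g y))"
proof -
  let ?X = "subtopology X' (f ` topspace X)" and ?Y = "subtopology Y' (g ` topspace Y)"
  obtain f' g' where "homeomorphic_maps X ?X f f'" "homeomorphic_maps Y ?Y g g'"
    using assms unfolding embedding_map_def homeomorphic_map_maps by blast
  then have "homeomorphic_map (prod_topology X Y) (prod_topology ?X ?Y) (\<lambda>(x,y). (f x, g y))"
    unfolding homeomorphic_map_maps using homeomorphic_maps_prod by metis
  moreover have "(\<lambda>(x,y). (f x, g y)) ` (topspace X \<times> topspace Y)
      = f ` topspace X \<times> g ` topspace Y"
    by force
  ultimately show ?thesis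
    unfolding embedding_map_def by (simp add: subtopology_Times)
qed

text \<open>The second projection is continuous and open, so it sends the interior of a compact set
  to an open subset of a compact set in \<open>Y\<close>.\<close>

lemma nowhere_locally_compact_space_prod_topology:
  assumes "nowhere_locally_compact_space Y"
  shows "nowhere_locally_compact_space (prod_topology X Y)"
  unfolding nowhere_locally_compact_space_def
proof (intro allI impI)
  fix K assume "compactin (prod_topology X Y) K"
  then have "compactin Y (snd ` K)"
    using image_compactin continuous_map_snd by blast
  then have "Y interior_of (snd ` K) = {}"
    using assms unfolding nowhere_locally_compact_space_def by blast
  moreover have "snd ` (prod_topology X Y interior_of K) \<subseteq> Y interior_of (snd ` K)"
    using open_map_snd[of X Y] openin_interior_of[of "prod_topology X Y" K]
    by (intro interior_of_maximal image_mono interior_of_subset) (auto simp: open_map_def)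
  ultimately show "prod_topology X Y interior_of K = {}"
    by blast
qed

text \<open>A compact set of irrationals is closed in the reals. If it contained all irrationals of
  a nonempty open set, it would by density contain its rationals too.\<close>

lemma nowhere_locally_compact_irrationals:
  fixes T :: "real set"
  assumes "open T"
  shows "nowhere_locally_compact_space (top_of_set (T - \<rat>))"
  unfolding nowhere_locally_compact_space_def
proof (intro allI impI, rule ccontr)
  fix S assume "compactin (top_of_set (T - \<rat>)) S"
    and "top_of_set (T - \<rat>) interior_of S \<noteq> {}"
  then have S: "compact S" "S \<subseteq> T - \<rat>"
    by (auto simp: compactin_subtopology)
  obtain x U where U: "open U" "x \<in> U \<inter> (T - \<rat>)" "U \<inter> (T - \<rat>) \<subseteq> S"
    using \<open>_ interior_of S \<noteq> {}\<close> unfolding interior_of_def openin_open by blast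
  define V where "V = U \<inter> T"
  have V: "open V" "V \<noteq> {}" "V - S \<subseteq> \<rat>"
    using U assms unfolding V_def by auto
  have "open (V - S)"
    using V(1) S(1) by (simp add: compact_imp_closed open_Diff)
  moreover have "countable (V - S)"
    using V(3) countable_rat countable_subset by blast
  \<comment> \<open>A countable open set of reals is empty.\<close>
  ultimately have "V \<subseteq> S"
    using open_minus_countable[of "V - S" "V - S"] by blast
  moreover obtain q where "q \<in> \<rat>" "q \<in> V"
    using V(1,2) open_Int_closure_eq_empty[of V "\<rat>"] Rats_closure_real by auto
  ultimately show False
    using S(2) by blast
qed

theorem theorem7p4:
  fixes X :: "'a topology"
  assumes "completely_regular_space X"
  shows "\<exists>(Y :: ('a \<times> real) topology) f.
           completely_regular_space Y \<and> Hausdorff_space Y \<and>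
           nowhere_locally_compact_space Y \<and>
           sigma_compact_space (stone_cech_remainder Y) \<and>
           continuous_map Y X f \<and> f ` topspace Y = topspace X"
proof -
  let ?D = "discrete_topology (topspace X)"
  let ?A = "Alexandroff_compactification ?D"
  let ?I = "top_of_set {0..1::real}"
  let ?K = "prod_topology ?A ?I"
  define P :: "real set" where "P = {0<..<1} - \<rat>"
  define Y where "Y = prod_topology ?D (top_of_set P)"
  define g where "g = (\<lambda>(d::'a, t::real). (Some d, t))"
  \<comment> \<open>The discrete first factor makes \<open>Y\<close> metrizable whatever the
    topology of \<open>X\<close>.\<close>
  have "metrizable_space Y"
    by (simp add: Y_def metrizable_space_prod_topology metrizable_space_subtopology
        metrizable_space_euclidean)
  then have Y: "completely_regular_space Y" "Hausdorff_space Y"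
    by (simp_all add: metrizable_imp_completely_regular_space metrizable_imp_Hausdorff_space)
  have nlc: "nowhere_locally_compact_space Y"
    unfolding Y_def P_def
    by (intro nowhere_locally_compact_space_prod_topology nowhere_locally_compact_irrationals) simp
  have K: "compact_space ?K" "Hausdorff_space ?K"
    by (simp_all add: compact_space_prod_topology compact_space_subtopology
        Hausdorff_space_prod_topology Hausdorff_space_Alexandroff_compactification
        locally_compact_space_discrete_topology Hausdorff_space_subtopology)
  have "embedding_map (top_of_set P) ?I id"
    by (auto simp: P_def embedding_map_def subtopology_subtopology
        intro!: arg_cong[where f = top_of_set])
  from embedding_map_prod [OF embedding_map_Some this] have emb: "embedding_map Y ?K g"
    by (simp add: Y_def g_def)
  have "topspace ?K - g ` topspace Y
      = \<Union>(insert ({None} \<times> {0..1}) ((\<lambda>q. topspace ?A \<times> {q}) ` (\<rat> \<inter> {0..1})))"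
    (is "_ = \<Union>?\<K>")
  proof (intro equalityI subsetI)
    fix p assume p: "p \<in> topspace ?K - g ` topspace Y"
    obtain a t where at: "p = (a, t)"
      by fastforce
    show "p \<in> \<Union>?\<K>"
    proof (cases "a = None \<or> t \<in> \<rat>")
      case False
      \<comment> \<open>Both endpoints are rational, so removing them from the interval creates no
        points beyond the rational slices.\<close>
      then have "t \<noteq> 0" "t \<noteq> 1"
        by auto
      with False p at have "t \<in> P" "a \<in> Some ` topspace X"
        by (auto simp: P_def)
      then have "p \<in> g ` topspace Y"
        unfolding at Y_def g_def by force
      with p show ?thesis
        by blast
    qed (use p at in auto)
  qed (auto simp: g_def Y_def P_def)
  moreover have "compactin ?K C" if "C \<in> ?\<K>" for C
  proof -
    have "compactin ?A {None}" "compactin ?A (topspace ?A)"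
      using compact_space_Alexandroff_compactification[of ?D] by (simp_all add: compact_space_def)
    with that show ?thesis
      by (auto simp: compactin_Times compactin_subtopology
          simp del: topspace_Alexandroff_compactification)
  qed
  moreover have "countable ?\<K>"
    by (simp add: countable_rat)
  ultimately have "sigma_compact_space (subtopology ?K (topspace ?K - g ` topspace Y))"
    unfolding sigma_compact_space_def compactin_subtopology
    by (intro exI[of _ ?\<K>]) auto
  then have rem: "sigma_compact_space (stone_cech_remainder Y)"
    by (rule sigma_compact_stone_cech_remainder [OF K emb])
  \<comment> \<open>The projection is continuous into the discrete space, from which the identity to
    \<open>X\<close> is continuous.\<close>
  have "continuous_map Y X fst"
    unfolding Y_def
    by (rule continuous_map_compose [OF continuous_map_fst, where g = id, simplified]) simp
  \<comment> \<open>A nonempty second factor makes \<open>fst\<close> surjective; the interval is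
    not covered by the countable set of rationals.\<close>
  moreover have "P \<noteq> {}"
    using open_minus_countable[OF countable_rat, of "{0<..<1}"] unfolding P_def by auto
  then have "fst ` topspace Y = topspace X"
    by (simp add: Y_def)
  ultimately show ?thesis
    using Y nlc rem by blast
qed

end
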